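(* Let $\mu\geq 3$ be an integer. Every $\mu$-way $(v,3,2)$ trade of minimum volume (i.e., whose volume equals the minimum volume of all $\mu$-way $(v',3,2)$ trades) is a Steiner trade.
   Context: A $(v,k,t)$ trade is a triple $(X;T_1,T_2)$ where $X$ is a $v$-set and $T_1,T_2$ are disjoint nonempty collections of $k$-subsets (blocks) of $X$ such that every $t$-subset of $X$ is contained in the same number of blocks of $T_1$ as of $T_2$. A $\mu$-way $(v,k,t)$ trade is a pair $T=(X,\{T_1,\dots,T_\mu\})$ such that for every $i\neq j$, $(X;T_i,T_j)$ is a $(v,k,t)$ trade. The volume of $T$ is the common number of blocks of the $T_i$. A $\mu$-way $(v,k,t)$ trade is a Steiner trade if every $t$-subset of $X$ is contained in at most one block of each $T_i$. *)

theory Defs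
  imports Main
begin

definition is_trade ::
  "nat \<Rightarrow> nat \<Rightarrow> nat \<Rightarrow> 'a set \<Rightarrow> 'a set set \<Rightarrow> 'a set set \<Rightarrow> bool" where
  "is_trade v k t X T1 T2 \<longleftrightarrow>
     finite X \<and> card X = v \<and>
     T1 \<noteq> {} \<and> T2 \<noteq> {} \<and> T1 \<inter> T2 = {} \<and>
     (\<forall>B \<in> T1 \<union> T2. B \<subseteq> X \<and> card B = k) \<and>
     (\<forall>S. S \<subseteq> X \<and> card S = t \<longrightarrow> card {B \<in> T1. S \<subseteq> B} = card {B \<in> T2. S \<subseteq> B})"

text \<open>The collections of a \<open>\<mu>\<close>-way trade form a family indexed by \<open>{1..\<mu>}\<close>; values of
  the family outside this range are irrelevant.\<close>

definition is_mu_way_trade ::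
  "nat \<Rightarrow> nat \<Rightarrow> nat \<Rightarrow> nat \<Rightarrow> 'a set \<Rightarrow> (nat \<Rightarrow> 'a set set) \<Rightarrow> bool" where
  "is_mu_way_trade \<mu> v k t X T \<longleftrightarrow>
     (\<forall>i \<in> {1..\<mu>}. \<forall>j \<in> {1..\<mu>}. i \<noteq> j \<longrightarrow> is_trade v k t X (T i) (T j))"

definition has_volume :: "nat \<Rightarrow> (nat \<Rightarrow> 'a set set) \<Rightarrow> nat \<Rightarrow> bool" where
  "has_volume \<mu> T m \<longleftrightarrow> (\<forall>i \<in> {1..\<mu>}. card (T i) = m)"

definition is_steiner :: "nat \<Rightarrow> nat \<Rightarrow> 'a set \<Rightarrow> (nat \<Rightarrow> 'a set set) \<Rightarrow> bool" where
  "is_steiner \<mu> t X T \<longleftrightarrow>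
     (\<forall>S. S \<subseteq> X \<and> card S = t \<longrightarrow> (\<forall>i \<in> {1..\<mu>}. card {B \<in> T i. S \<subseteq> B} \<le> 1))"

text \<open>The minimum ranges over all (finite) point sets. Since every finite set is in bijection
  with a set of natural numbers, it suffices to let the point set range over sets of naturals,
  which makes the minimum independent of the point type of any particular trade.\<close>

definition min_volume :: "nat \<Rightarrow> nat \<Rightarrow> nat \<Rightarrow> nat" where
  "min_volume \<mu> k t =
     (LEAST m. \<exists>v' (X' :: nat set) T'. is_mu_way_trade \<mu> v' k t X' T' \<and> has_volume \<mu> T' m)"

end

theory Submission
  imports Defs "HOL-Library.Ramsey" "HOL-Library.Code_Binary_Nat"
begin

text \<open>
  If some pair \<open>xy\<close> lies in at least two blocks of each \<open>T\<^sub>i\<close>, then the third points of the blocks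
  through \<open>xy\<close> are distinct over all \<open>i\<close>, which gives at least \<open>2\<mu>\<close> of them. The same count in the
  neighbourhood of a single point shows that every point of the trade lies in at least
  \<open>(\<mu> + 1)/2\<close> blocks of \<open>T\<^sub>1\<close>, and that \<open>x\<close> and \<open>y\<close> lie in at least \<open>\<mu> + 1\<close>. Summing degrees, the
  volume of a trade that is not Steiner is at least about \<open>(\<mu> + 1)(\<mu> + 2)/3\<close>.

  This is twice the volume of a Steiner triple system on \<open>\<mu> + 2\<close> points, so it suffices to
  exhibit trades that are moderately efficient. For \<open>\<mu> \<ge> 23\<close> these are obtained from a large set of
  seven disjoint Steiner triple systems of order 9 by replacing each point by \<open>g\<close> copies and each
  block by the \<open>g\<close> Latin squares \<open>a + b + c \<equiv> j (mod g)\<close>, which yields \<open>7g\<close> ways of volume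
  \<open>12g\<^sup>2\<close>. Smaller \<open>\<mu>\<close> are covered by a few explicit systems.
\<close>

section \<open>Degrees in uniform set systems\<close>

definition degree :: "'a set set \<Rightarrow> 'a set \<Rightarrow> nat" where
  "degree A S = card {B \<in> A. S \<subseteq> B}"

lemma degree_empty [simp]: "degree A {} = card A"
  by (simp add: degree_def)

lemma degree_pos:
  assumes "finite A" "B \<in> A" "S \<subseteq> B"
  shows "0 < degree A S"
  using assms by (auto simp: degree_def card_gt_0_iff)

lemma finite_subset_nsets: "finite X \<Longrightarrow> A \<subseteq> [X]\<^bsup>k\<^esup> \<Longrightarrow> finite A"
  by (rule finite_subset[OF _ finite_imp_finite_nsets])

lemma sum_degree_insert:
  assumes X: "finite X" and A: "A \<subseteq> [X]\<^bsup>k\<^esup>" and S: "finite S"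
  shows "(\<Sum>y\<in>X - S. degree A (insert y S)) = (k - card S) * degree A S"
proof -
  let ?AS = "{B \<in> A. S \<subseteq> B}"
  have "card {y \<in> X - S. y \<in> B} = k - card S" if "B \<in> ?AS" for B
  proof -
    have "{y \<in> X - S. y \<in> B} = B - S" using A that by (auto simp: nsets_def)
    then show ?thesis using A S that by (auto simp: nsets_def card_Diff_subset)
  qed
  then have "(\<Sum>y\<in>X - S. card {B \<in> ?AS. y \<in> B}) = (k - card S) * card ?AS"
    using X finite_subset_nsets[OF X A] by (intro sum_multicount) auto
  moreover have "{B \<in> ?AS. y \<in> B} = {B \<in> A. insert y S \<subseteq> B}" for y
    by auto
  ultimately show ?thesis by (simp add: degree_def)
qed

lemma degree_image:
  assumes f: "inj_on f X" and A: "A \<subseteq> [X]\<^bsup>k\<^esup>" and S: "S \<subseteq> X"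
  shows "degree (image f ` A) (f ` S) = degree A S"
proof -
  have "f ` S \<subseteq> f ` B \<longleftrightarrow> S \<subseteq> B" if "B \<in> A" for B
  proof -
    have "B \<subseteq> X" using A that by (auto simp: nsets_def)
    then show ?thesis
      using inj_on_image_mem_iff[OF f] S unfolding image_subset_iff subset_iff by blast
  qed
  then have "{C \<in> image f ` A. f ` S \<subseteq> C} = image f ` {B \<in> A. S \<subseteq> B}"
    by auto
  moreover have "inj_on (image f) {B \<in> A. S \<subseteq> B}"
    by (rule inj_on_subset[OF inj_on_nsets[OF f, of k]]) (use A in blast)
  ultimately show ?thesis by (simp add: degree_def card_image)
qed

section \<open>Trades\<close>

lemma is_trade_iff:
  "is_trade v k t X A B \<longleftrightarrow>
     finite X \<and> card X = v \<and> A \<noteq> {} \<and> B \<noteq> {} \<and> A \<inter> B = {} \<and> A \<subseteq> [X]\<^bsup>k\<^esup> \<and> B \<subseteq> [X]\<^bsup>k\<^esup> \<and>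
     (\<forall>S\<in>[X]\<^bsup>t\<^esup>. degree A S = degree B S)"
proof (cases "finite X")
  case True
  then have mem: "C \<in> [X]\<^bsup>s\<^esup> \<longleftrightarrow> C \<subseteq> X \<and> card C = s" for C s
    by (auto simp: nsets_def intro: finite_subset)
  have blocks: "(\<forall>C\<in>A \<union> B. C \<subseteq> X \<and> card C = k) \<longleftrightarrow> A \<subseteq> [X]\<^bsup>k\<^esup> \<and> B \<subseteq> [X]\<^bsup>k\<^esup>"
    unfolding subset_iff[of A] subset_iff[of B] mem by blast
  show ?thesis
    unfolding is_trade_def degree_def blocks Ball_def[of "[X]\<^bsup>t\<^esup>"] mem by (simp only: conj_assoc)
qed (simp add: is_trade_def)

lemma is_trade_degree_eq:
  assumes trade: "is_trade v k t X A B" and "t \<le> k" and S: "S \<subseteq> X" "card S \<le> t"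
  shows "degree A S = degree B S"
  using S
proof (induction "t - card S" arbitrary: S)
  case 0
  moreover have "finite S" using 0(2) trade finite_subset unfolding is_trade_iff by blast
  ultimately have "S \<in> [X]\<^bsup>t\<^esup>" by (simp add: nsets_def)
  then show ?case using trade by (simp add: is_trade_iff)
next
  case (Suc d)
  have X: "finite X" "A \<subseteq> [X]\<^bsup>k\<^esup>" "B \<subseteq> [X]\<^bsup>k\<^esup>" using trade by (auto simp: is_trade_iff)
  have S: "finite S" "card S < k"
    using Suc.hyps(2) Suc.prems \<open>t \<le> k\<close> X(1) by (auto intro: finite_subset)
  have "degree A (insert y S) = degree B (insert y S)" if "y \<in> X - S" for y
    using that Suc.hyps(2) Suc.prems S(1) by (intro Suc.hyps(1)) auto
  then have "(k - card S) * degree A S = (k - card S) * degree B S"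
    by (simp flip: sum_degree_insert[OF X(1) _ S(1)] add: X)
  then show ?case using S(2) by simp
qed

lemma is_trade_image:
  assumes trade: "is_trade v k t X A B" and f: "inj_on f X"
  shows "is_trade v k t (f ` X) (image f ` A) (image f ` B)"
proof -
  have nsets: "[f ` X]\<^bsup>s\<^esup> = image f ` [X]\<^bsup>s\<^esup>" for s
    using bij_betw_nsets[OF inj_on_imp_bij_betw[OF f]] by (simp add: bij_betw_def)
  have blocks: "A \<subseteq> [X]\<^bsup>k\<^esup>" "B \<subseteq> [X]\<^bsup>k\<^esup>" and "A \<inter> B = {}"
    using trade by (auto simp: is_trade_iff)
  then have "image f ` A \<inter> image f ` B = {}"
    using inj_on_image_Int[OF inj_on_nsets[OF f] blocks] by simp
  moreover have "degree (image f ` A) (f ` S) = degree (image f ` B) (f ` S)" if "S \<in> [X]\<^bsup>t\<^esup>" for S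
  proof -
    have "S \<subseteq> X" using that by (simp add: nsets_def)
    then show ?thesis
      using degree_image[OF f blocks(1)] degree_image[OF f blocks(2)] trade that
      by (simp add: is_trade_iff)
  qed
  ultimately show ?thesis
    using trade f blocks by (auto simp: is_trade_iff nsets card_image)
qed

locale mu_way_trade =
  fixes \<mu> v k t :: nat and X :: "'a set" and T :: "nat \<Rightarrow> 'a set set"
  assumes two_le: "2 \<le> \<mu>" and mu_way: "is_mu_way_trade \<mu> v k t X T"
begin

lemma is_trade: "i \<in> {1..\<mu>} \<Longrightarrow> j \<in> {1..\<mu>} \<Longrightarrow> i \<noteq> j \<Longrightarrow> is_trade v k t X (T i) (T j)"
  using mu_way by (simp add: is_mu_way_trade_def)

lemma obtain_trade:
  assumes "i \<in> {1..\<mu>}"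
  obtains j where "is_trade v k t X (T i) (T j)"
proof -
  obtain j where "j \<in> {1..\<mu>}" "i \<noteq> j"
    using two_le that[of 1] that[of 2] by (cases "i = 1") auto
  then show ?thesis using is_trade[OF assms] that by blast
qed

lemma one_index: "1 \<in> {1..\<mu>}"
  using two_le by simp

lemma finite_points: "finite X" and card_points: "card X = v"
  using obtain_trade[OF one_index] by (auto simp: is_trade_iff)

lemma
  assumes "i \<in> {1..\<mu>}"
  shows blocks_subset: "T i \<subseteq> [X]\<^bsup>k\<^esup>" and blocks_nonempty: "T i \<noteq> {}"
  using obtain_trade[OF assms] by (auto simp: is_trade_iff)

lemma finite_blocks: "i \<in> {1..\<mu>} \<Longrightarrow> finite (T i)"
  using finite_subset_nsets[OF finite_points blocks_subset] .

lemma disjoint: "i \<in> {1..\<mu>} \<Longrightarrow> j \<in> {1..\<mu>} \<Longrightarrow> i \<noteq> j \<Longrightarrow> T i \<inter> T j = {}"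
  using is_trade by (simp add: is_trade_iff)

lemma degree_eq:
  assumes "t \<le> k" "i \<in> {1..\<mu>}" "j \<in> {1..\<mu>}" "S \<subseteq> X" "card S \<le> t"
  shows "degree (T i) S = degree (T j) S"
  using is_trade_degree_eq[OF is_trade[OF assms(2,3)] assms(1,4,5)] by (cases "i = j") simp_all

lemma min_volume_le:
  assumes \<nu>: "2 \<le> \<nu>" "\<nu> \<le> \<mu>" and "t \<le> k"
  shows "min_volume \<nu> k t \<le> card (T 1)"
proof -
  obtain f :: "'a \<Rightarrow> nat" where f: "inj_on f X"
    using finite_imp_inj_to_nat_seg[OF finite_points] by blast
  let ?T = "\<lambda>i. image f ` T i"
  have "is_mu_way_trade \<nu> v k t (f ` X) ?T"
    using is_trade is_trade_image[OF _ f] \<nu>(2) by (simp add: is_mu_way_trade_def)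
  moreover have "has_volume \<nu> ?T (card (T 1))"
    unfolding has_volume_def
  proof
    fix i assume "i \<in> {1..\<nu>}"
    then have i: "i \<in> {1..\<mu>}" using \<nu> by simp
    have "card (?T i) = card (T i)"
      using inj_on_subset[OF inj_on_nsets[OF f] blocks_subset[OF i]] by (rule card_image)
    then show "card (?T i) = card (T 1)"
      using degree_eq[OF \<open>t \<le> k\<close> i one_index, of "{}"] by simp
  qed
  ultimately show ?thesis
    unfolding min_volume_def by (intro Least_le exI conjI)
qed

end

section \<open>Non-Steiner triple trades are large\<close>

locale mu_way_Suc_trade = mu_way_trade \<mu> v "Suc t" t X T
  for \<mu> v t :: nat and X :: "'a set" and T :: "nat \<Rightarrow> 'a set set"
begin

definition extensions :: "'a set \<Rightarrow> 'a set" where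
  "extensions S = {z. \<exists>i\<in>{1..\<mu>}. insert z S \<in> T i}"

lemma extensions_subset:
  assumes "S \<in> [X]\<^bsup>t\<^esup>"
  shows "extensions S \<subseteq> X - S"
proof
  fix z assume "z \<in> extensions S"
  then have "insert z S \<in> [X]\<^bsup>Suc t\<^esup>" using blocks_subset unfolding extensions_def by blast
  then show "z \<in> X - S" using assms by (auto simp: nsets_def insert_absorb)
qed

lemma card_extensions:
  assumes S: "S \<in> [X]\<^bsup>t\<^esup>"
  shows "card (extensions S) = \<mu> * degree (T 1) S"
proof -
  let ?U = "\<Union>i\<in>{1..\<mu>}. {B \<in> T i. S \<subseteq> B}"
  have S': "S \<subseteq> X" "finite S" "card S = t" using S by (auto simp: nsets_def)
  have "bij_betw (\<lambda>z. insert z S) (extensions S) ?U"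
  proof (rule bij_betw_imageI)
    show "inj_on (\<lambda>z. insert z S) (extensions S)"
      using extensions_subset[OF S] by (auto simp: inj_on_def)
    have "B \<in> (\<lambda>z. insert z S) ` extensions S" if B: "B \<in> T i" "S \<subseteq> B" "i \<in> {1..\<mu>}" for B i
    proof -
      have "card B = Suc t" using blocks_subset[OF B(3)] B(1) by (auto simp: nsets_def)
      then have "card (B - S) = 1" using B(2) S' by (simp add: card_Diff_subset)
      then obtain z where "B - S = {z}" by (auto simp: card_1_singleton_iff)
      then have "B = insert z S" using B(2) by blast
      then show ?thesis using B unfolding extensions_def by blast
    qed
    then show "(\<lambda>z. insert z S) ` extensions S = ?U"
      by (auto simp: extensions_def)
  qed
  then have "card (extensions S) = card ?U" by (rule bij_betw_same_card)
  also have "\<dots> = (\<Sum>i\<in>{1..\<mu>}. degree (T i) S)"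
    unfolding degree_def
    using finite_blocks disjoint by (intro card_UN_disjoint) (simp, simp, blast)
  also have "\<dots> = (\<Sum>i\<in>{1..\<mu>}. degree (T 1) S)"
    using S' one_index by (intro sum.cong degree_eq) auto
  finally show ?thesis by simp
qed

lemma degree_extension_pos:
  assumes "z \<in> extensions S" "R \<subseteq> insert z S" "R \<in> [X]\<^bsup>t\<^esup>"
  shows "0 < degree (T 1) R"
proof -
  obtain i where i: "i \<in> {1..\<mu>}" "insert z S \<in> T i" using assms(1) by (auto simp: extensions_def)
  then have "0 < degree (T i) R" using degree_pos[OF finite_blocks] assms(2) by blast
  then show ?thesis
    using degree_eq[OF _ i(1) one_index, of R] assms(3) by (simp add: nsets_def)
qed

lemma degree_insert_le:
  assumes yS: "insert y S \<in> [X]\<^bsup>t\<^esup>" and y: "y \<notin> S"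
  shows "(\<mu> + 1) * degree (T 1) (insert y S) \<le> 2 * degree (T 1) S"
proof -
  let ?d = "\<lambda>z. degree (T 1) (insert z S)" and ?Z = "extensions (insert y S)"
  have S: "finite S" "Suc (card S) = t" "insert y S \<subseteq> X" using yS y by (auto simp: nsets_def)
  have Z: "?Z \<subseteq> X - insert y S" "finite ?Z"
    using extensions_subset[OF yS] finite_points by (auto intro: finite_subset)
  have "1 \<le> ?d z" if "z \<in> ?Z" for z
  proof -
    have "insert z S \<in> [X]\<^bsup>t\<^esup>" using that Z(1) S by (auto simp: nsets_def)
    then show ?thesis using degree_extension_pos[OF that] 
      by (simp add: Suc_le_eq subset_insertI2 insert_mono)
  qed
  then have "card ?Z \<le> (\<Sum>z\<in>?Z. ?d z)" using sum_mono[of ?Z "\<lambda>_. 1" ?d] by simp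
  then have "(\<mu> + 1) * ?d y \<le> (\<Sum>z\<in>insert y ?Z. ?d z)"
    using Z by (subst sum.insert) (auto simp: card_extensions[OF yS])
  also have "\<dots> \<le> (\<Sum>z\<in>X - S. ?d z)"
    using Z(1) S(3) y finite_points by (intro sum_mono2) auto
  also have "\<dots> = 2 * degree (T 1) S"
    using sum_degree_insert[OF finite_points blocks_subset[OF one_index] S(1)] S(2) by auto
  finally show ?thesis .
qed

end

text \<open>A lower bound for the sum of all degrees if two points \<open>x\<close> and \<open>y\<close> lie in two common blocks:
  \<open>\<mu> + 1\<close> for each of \<open>x\<close> and \<open>y\<close>, and \<open>\<mu> div 2 + 1\<close> for each of \<open>2\<mu>\<close> third points.\<close>

definition repeated_pair_bound :: "nat \<Rightarrow> nat" where
  "repeated_pair_bound \<mu> = 2 * (\<mu> + 1) + 2 * \<mu> * (\<mu> div 2 + 1)"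

lemma repeated_pair_bound_mono: "m \<le> n \<Longrightarrow> repeated_pair_bound m \<le> repeated_pair_bound n"
  unfolding repeated_pair_bound_def by (intro add_mono mult_le_mono div_le_mono) auto

locale mu_way_triple_trade = mu_way_Suc_trade \<mu> v 2 X T
  for \<mu> v :: nat and X :: "'a set" and T :: "nat \<Rightarrow> 'a set set"
begin

lemma point_degree_ge:
  assumes "{x, y} \<in> [X]\<^bsup>2\<^esup>" "m \<le> degree (T 1) {x, y}"
  shows "(\<mu> + 1) * m \<le> 2 * degree (T 1) {x}"
proof -
  have "(\<mu> + 1) * m \<le> (\<mu> + 1) * degree (T 1) {y, x}"
    using mult_le_mono2[OF assms(2)] by (simp only: insert_commute)
  also have "\<dots> \<le> 2 * degree (T 1) {x}"
    using assms(1) by (intro degree_insert_le) (auto simp: insert_commute)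
  finally show ?thesis .
qed

lemma repeated_pair_bound_le:
  assumes xy: "{x, y} \<in> [X]\<^bsup>2\<^esup>" and repeated: "2 \<le> degree (T 1) {x, y}"
  shows "repeated_pair_bound \<mu> \<le> 3 * card (T 1)"
proof -
  let ?r = "\<lambda>z. degree (T 1) {z}" and ?Z = "extensions {x, y}"
  have Z: "?Z \<subseteq> X - {x, y}" "finite ?Z"
    using extensions_subset[OF xy] finite_points by (auto intro: finite_subset)
  have "x \<noteq> y" using xy by simp
  have "\<mu> + 1 \<le> ?r x" "\<mu> + 1 \<le> ?r y"
    using point_degree_ge[OF xy repeated] point_degree_ge[of y x 2] xy repeated
    by (simp_all add: insert_commute)
  then have xy_degrees: "2 * (\<mu> + 1) \<le> ?r x + ?r y" by simp
  have "\<mu> div 2 + 1 \<le> ?r z" if "z \<in> ?Z" for z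
  proof -
    have zx: "{z, x} \<in> [X]\<^bsup>2\<^esup>" using that Z(1) xy by auto
    then have "1 \<le> degree (T 1) {z, x}"
      using degree_extension_pos[OF that _ zx] by (simp add: Suc_le_eq)
    from point_degree_ge[OF zx this] show ?thesis by simp
  qed
  then have "card ?Z * (\<mu> div 2 + 1) \<le> (\<Sum>z\<in>?Z. ?r z)"
    using sum_bounded_below[of ?Z "\<mu> div 2 + 1" ?r] by simp
  moreover have "2 * \<mu> \<le> card ?Z"
    using repeated by (simp add: card_extensions[OF xy])
  ultimately have Z_degrees: "2 * \<mu> * (\<mu> div 2 + 1) \<le> (\<Sum>z\<in>?Z. ?r z)"
    using mult_le_mono1 order_trans by blast
  have "repeated_pair_bound \<mu> \<le> ?r x + ?r y + (\<Sum>z\<in>?Z. ?r z)"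
    unfolding repeated_pair_bound_def using xy_degrees Z_degrees by (rule add_mono)
  also have "\<dots> = (\<Sum>z\<in>insert x (insert y ?Z). ?r z)"
    using Z \<open>x \<noteq> y\<close> by (auto simp: sum.insert_if)
  also have "\<dots> \<le> (\<Sum>z\<in>X. ?r z)"
    using Z(1) xy finite_points by (intro sum_mono2) auto
  also have "\<dots> = 3 * card (T 1)"
    using sum_degree_insert[OF finite_points blocks_subset[OF one_index], of "{}"] by simp
  finally show ?thesis .
qed

lemma not_steiner_imp_repeated_pair_bound_le:
  assumes "\<not> is_steiner \<mu> 2 X T"
  shows "repeated_pair_bound \<mu> \<le> 3 * card (T 1)"
proof -
  from assms obtain S i where S: "S \<subseteq> X" "card S = 2" "i \<in> {1..\<mu>}" "2 \<le> degree (T i) S"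
    by (auto simp: is_steiner_def degree_def not_le Suc_le_eq)
  then obtain x y where xy: "S = {x, y}" "x \<noteq> y" by (auto simp: card_2_iff)
  have "2 \<le> degree (T 1) {x, y}"
    using degree_eq[OF _ S(3) one_index S(1)] S xy by simp
  then show ?thesis using repeated_pair_bound_le[of x y] S(1) xy by simp
qed

end

section \<open>Trades from the orbit of a permutation\<close>

lemma image_funpow_subset_nsets:
  assumes "bij_betw \<pi> X X" and "A \<subseteq> [X]\<^bsup>k\<^esup>"
  shows "image (\<pi> ^^ i) ` A \<subseteq> [X]\<^bsup>k\<^esup>"
  using image_mono[OF assms(2)] bij_betw_nsets[OF bij_betw_funpow[OF assms(1)]]
  by (metis bij_betw_imp_surj_on)

lemma degree_image_funpow:
  assumes \<pi>: "bij_betw \<pi> X X" and A: "A \<subseteq> [X]\<^bsup>k\<^esup>"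
    and invariant: "\<And>S. S \<in> [X]\<^bsup>t\<^esup> \<Longrightarrow> degree A (\<pi> ` S) = degree A S"
    and S: "S \<in> [X]\<^bsup>t\<^esup>"
  shows "degree (image (\<pi> ^^ i) ` A) S = degree A S"
  using S
proof (induction i arbitrary: S)
  case (Suc i)
  then obtain R where R: "R \<in> [X]\<^bsup>t\<^esup>" "S = \<pi> ` R"
    using bij_betw_imp_surj_on[OF bij_betw_nsets[OF \<pi>]] by blast
  then have "R \<subseteq> X" by (simp add: nsets_def)
  then have "degree (image \<pi> ` image (\<pi> ^^ i) ` A) S = degree (image (\<pi> ^^ i) ` A) R"
    unfolding R(2)
    by (rule degree_image[OF bij_betw_imp_inj_on[OF \<pi>] image_funpow_subset_nsets[OF \<pi> A]])
  then show ?case using Suc.IH[OF R(1)] invariant[OF R(1)] R(2) by (simp add: image_image)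
qed simp

lemma is_mu_way_trade_orbit:
  assumes X: "finite X" and \<pi>: "bij_betw \<pi> X X"
    and A: "A \<subseteq> [X]\<^bsup>k\<^esup>" "A \<noteq> {}"
    and invariant: "\<And>S. S \<in> [X]\<^bsup>t\<^esup> \<Longrightarrow> degree A (\<pi> ` S) = degree A S"
    and disjoint: "\<And>m. m \<in> {1..<n} \<Longrightarrow> image (\<pi> ^^ m) ` A \<inter> A = {}"
  shows "is_mu_way_trade n (card X) k t X (\<lambda>i. image (\<pi> ^^ i) ` A)"
proof -
  let ?T = "\<lambda>i. image (\<pi> ^^ i) ` A"
  have inj: "inj_on (\<pi> ^^ i) X" for i
    using bij_betw_funpow[OF \<pi>] by (rule bij_betw_imp_inj_on)
  have blocks: "?T i \<subseteq> [X]\<^bsup>k\<^esup>" for i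
    using \<pi> A(1) by (rule image_funpow_subset_nsets)
  have degree: "degree (?T i) S = degree A S" if "S \<in> [X]\<^bsup>t\<^esup>" for i S
    using degree_image_funpow[OF \<pi> A(1) invariant that] .
  have less: "?T i \<inter> ?T j = {}" if "1 \<le> i" "i < j" "j \<le> n" for i j
  proof -
    have "?T j = image (\<pi> ^^ i) ` ?T (j - i)"
      using that funpow_add[of i "j - i" \<pi>] by (simp add: image_image image_comp[symmetric] o_def)
    then have "?T i \<inter> ?T j = image (\<pi> ^^ i) ` (A \<inter> ?T (j - i))"
      using inj_on_image_Int[OF inj_on_nsets[OF inj] A(1) blocks] by simp
    also have "A \<inter> ?T (j - i) = {}"
    proof -
      have "j - i \<in> {1..<n}" using that by auto
      then show ?thesis using disjoint by blast
    qed
    finally show ?thesis by simp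
  qed
  have "?T i \<inter> ?T j = {}" if "i \<in> {1..n}" "j \<in> {1..n}" "i \<noteq> j" for i j
    using less[of i j] less[of j i] that by (cases i j rule: linorder_cases) auto
  then show ?thesis
    using X A(2) blocks degree by (simp add: is_mu_way_trade_def is_trade_iff)
qed

definition rotation :: "nat \<Rightarrow> nat \<Rightarrow> nat \<Rightarrow> nat" where
  "rotation n k p = (if p < n then (p + k) mod n else p)"

lemma funpow_rotation: "rotation n 1 ^^ k = rotation n k"
proof (induction k)
  case 0
  show ?case by (auto simp: rotation_def)
next
  case (Suc k)
  then show ?case by (auto simp: rotation_def mod_simps)
qed

lemma inj_rotation: "inj (rotation n k)"
proof -
  have "inj (rotation n 1)" by (auto simp: inj_def rotation_def mod_Suc split: if_splits)
  then have "inj (rotation n 1 ^^ k)" by (rule inj_fn)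
  then show ?thesis by (simp only: funpow_rotation)
qed

lemma bij_betw_rotation:
  assumes "n \<le> N"
  shows "bij_betw (rotation n k) {..<N} {..<N}"
proof -
  have "rotation n k ` {..<N} \<subseteq> {..<N}"
    using assms by (auto simp: rotation_def intro: less_le_trans[OF mod_less_divisor])
  then show ?thesis
    using inj_on_subset[OF inj_rotation] by (simp add: bij_betw_def endo_inj_surj)
qed

definition star :: "'a list list \<Rightarrow> 'a \<Rightarrow> 'a list" where
  "star D a = concat (filter (\<lambda>B. a \<in> set B) D)"

lemma count_list_distinct: "distinct xs \<Longrightarrow> count_list xs x = (if x \<in> set xs then 1 else 0)"
  by (induction xs) auto

lemma count_list_insort: "count_list (insort x xs) y = count_list (x # xs) y"
  by (induction xs) auto

lemma count_list_sort: "count_list (sort xs) x = count_list xs x"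
  by (induction xs) (auto simp: count_list_insort)

lemma count_list_star:
  assumes "\<forall>B\<in>set D. distinct B"
  shows "count_list (star D a) b = length (filter (\<lambda>B. {a, b} \<subseteq> set B) D)"
  using assms by (induction D) (auto simp: star_def count_list_distinct)

text \<open>Blocks are written as increasing lists; the condition on \<open>star\<close> says that \<open>a\<close> and \<open>b\<close> lie
  together in as many blocks as their images under the rotation.\<close>

definition cyclic_base :: "nat \<Rightarrow> nat \<Rightarrow> nat \<Rightarrow> nat list list \<Rightarrow> bool" where
  "cyclic_base k n N D \<longleftrightarrow> n \<le> N \<and> D \<noteq> [] \<and> distinct D \<and>
     (\<forall>B\<in>set D. sorted_wrt (<) B \<and> length B = k \<and> (\<forall>p\<in>set B. p < N)) \<and>
     (\<forall>a\<in>set [0..<N]. sort (star D (rotation n 1 a)) = sort (map (rotation n 1) (star D a))) \<and>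
     (\<forall>m\<in>{1..<n}. \<forall>B\<in>set D. sort (map (rotation n m) B) \<notin> set D)"

lemma degree_set_blocks:
  fixes D :: "'a::linorder list list"
  assumes D: "distinct D" "\<forall>B\<in>set D. sorted_wrt (<) B"
  shows "degree (set ` set D) {a, b} = count_list (star D a) b"
proof -
  have "inj_on set (set D)"
  proof (rule inj_onI)
    fix B C assume "B \<in> set D" "C \<in> set D" "set B = set C"
    then show "B = C"
      using D(2) by (intro sorted_distinct_set_unique) (simp_all add: strict_sorted_iff)
  qed
  then have "card (set ` {B \<in> set D. {a, b} \<subseteq> set B}) = card {B \<in> set D. {a, b} \<subseteq> set B}"
    by (rule card_image[OF inj_on_subset]) blast
  moreover have "{B \<in> set ` set D. {a, b} \<subseteq> B} = set ` {B \<in> set D. {a, b} \<subseteq> set B}"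
    by auto
  moreover have "length (filter (\<lambda>B. {a, b} \<subseteq> set B) D) = card {B \<in> set D. {a, b} \<subseteq> set B}"
    using distinct_length_filter[OF D(1)] by (simp add: Int_def conj_commute)
  moreover have "\<forall>B\<in>set D. distinct B"
    using D(2) by (auto simp: strict_sorted_iff)
  ultimately show ?thesis by (simp add: degree_def count_list_star)
qed

lemma cyclic_base_degree_rotation:
  assumes D: "cyclic_base k n N D" and S: "S \<in> [{..<N}]\<^bsup>2\<^esup>"
  shows "degree (set ` set D) (rotation n 1 ` S) = degree (set ` set D) S"
proof -
  let ?\<rho> = "rotation n 1"
  obtain a b where S: "S = {a, b}" "a < N" using S by (auto elim!: nsets2_E)
  have "sort (star D (?\<rho> a)) = sort (map ?\<rho> (star D a))"
    using D S(2) by (simp add: cyclic_base_def)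
  then have "count_list (star D (?\<rho> a)) (?\<rho> b) = count_list (map ?\<rho> (star D a)) (?\<rho> b)"
    by (metis count_list_sort)
  also have "\<dots> = count_list (star D a) b"
    by (rule count_list_map_conv[OF inj_rotation])
  finally show ?thesis
    using D unfolding S(1) cyclic_base_def by (simp add: degree_set_blocks)
qed

lemma cyclic_base_rotation_disjoint:
  assumes D: "cyclic_base k n N D" and m: "m \<in> {1..<n}"
  shows "image (rotation n m) ` set ` set D \<inter> set ` set D = {}"
proof -
  have False if "B \<in> set D" "C \<in> set D" "rotation n m ` set B = set C" for B C
  proof -
    have sorted: "sorted_wrt (<) B" "sorted_wrt (<) C"
      and avoids: "sort (map (rotation n m) B) \<notin> set D"
      using D m that(1,2) by (auto simp: cyclic_base_def)
    have "sort (map (rotation n m) B) = C"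
      using sorted that(3) inj_on_subset[OF inj_rotation]
      by (intro sorted_distinct_set_unique) (auto simp: strict_sorted_iff distinct_map)
    then show False using avoids that(2) by simp
  qed
  then show ?thesis by blast
qed

lemma is_mu_way_trade_cyclic_base:
  assumes D: "cyclic_base k n N D"
  shows "is_mu_way_trade n N k 2 {..<N} (\<lambda>i. image (rotation n i) ` set ` set D)"
proof -
  have "n \<le> N" "D \<noteq> []" using D by (auto simp: cyclic_base_def)
  have "set B \<in> [{..<N}]\<^bsup>k\<^esup>" if "B \<in> set D" for B
    using D that by (auto simp: cyclic_base_def nsets_def strict_sorted_iff distinct_card)
  then have "set ` set D \<subseteq> [{..<N}]\<^bsup>k\<^esup>" by blast
  then have "is_mu_way_trade n (card {..<N}) k 2 {..<N}
      (\<lambda>i. image (rotation n 1 ^^ i) ` set ` set D)"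
    using \<open>D \<noteq> []\<close> cyclic_base_degree_rotation[OF D] cyclic_base_rotation_disjoint[OF D]
    by (intro is_mu_way_trade_orbit bij_betw_rotation \<open>n \<le> N\<close>)
      (simp_all add: funpow_rotation del: One_nat_def)
  then show ?thesis by (simp add: funpow_rotation del: One_nat_def)
qed

section \<open>Blowing up points\<close>

text \<open>The copy \<open>(x, r)\<close> of the last point of a block is determined by the copies of its other
  points, because \<open>r\<close> is the only unknown in the condition on the sum.\<close>

definition blow_up :: "nat \<Rightarrow> nat \<Rightarrow> 'a set set \<Rightarrow> ('a \<times> nat) set set" where
  "blow_up g j A =
     {B. B \<subseteq> UNIV \<times> {..<g} \<and> inj_on fst B \<and> fst ` B \<in> A \<and> (\<Sum>p\<in>B. snd p) mod g = j}"

lemma ex1_add_mod_eq: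
  fixes g j s :: nat
  assumes "j < g"
  shows "\<exists>!r. r < g \<and> (r + s) mod g = j"
proof (rule ex1I)
  have "j + (g - 1) * s + s = j + g * s" using assms by (cases g) simp_all
  then have "((j + (g - 1) * s) mod g + s) mod g = j"
    using assms by (simp only: mod_add_left_eq mod_mult_self2 mod_less)
  then show "(j + (g - 1) * s) mod g < g \<and> ((j + (g - 1) * s) mod g + s) mod g = j"
    using assms by simp
next
  fix r assume r: "r < g \<and> (r + s) mod g = j"
  have "r + s + (g - 1) * s = r + g * s" using assms by (cases g) simp_all
  then have "(j + (g - 1) * s) mod g = (r + g * s) mod g"
    using r by (metis mod_add_left_eq)
  then show "r = (j + (g - 1) * s) mod g" using r by simp
qed

lemma blow_up_subset_nsets:
  assumes "A \<subseteq> [X]\<^bsup>k\<^esup>"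
  shows "blow_up g j A \<subseteq> [X \<times> {..<g}]\<^bsup>k\<^esup>"
proof
  fix B assume B: "B \<in> blow_up g j A"
  then have "fst ` B \<in> [X]\<^bsup>k\<^esup>" "inj_on fst B" using assms by (auto simp: blow_up_def)
  then have "B \<subseteq> X \<times> UNIV" "finite B" "card B = k"
    by (auto simp: nsets_def card_image dest: finite_imageD)
  then show "B \<in> [X \<times> {..<g}]\<^bsup>k\<^esup>" using B by (auto simp: blow_up_def nsets_def)
qed

lemma blow_up_superset_cases:
  assumes A: "A \<subseteq> [X]\<^bsup>Suc t\<^esup>" and S: "finite S" "card S = t"
    and B: "B \<in> blow_up g j A" "S \<subseteq> B"
  obtains c r where "B = insert (c, r) S" "c \<notin> fst ` S" "r < g" "(r + (\<Sum>p\<in>S. snd p)) mod g = j"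
proof -
  have "card B = Suc t" using blow_up_subset_nsets[OF A] B(1) by (auto simp: nsets_def)
  then have "card (B - S) = 1" using S B(2) by (simp add: card_Diff_subset)
  then obtain c r where "B - S = {(c, r)}" by (auto simp: card_1_singleton_iff)
  then have cr: "B = insert (c, r) S" "(c, r) \<notin> S" using B(2) by blast+
  then have "c \<notin> fst ` S" "r < g" "(r + (\<Sum>p\<in>S. snd p)) mod g = j"
    using B(1) S(1) by (auto simp: blow_up_def)
  with cr(1) show ?thesis by (rule that)
qed

lemma bij_betw_blow_up_supersets:
  assumes A: "A \<subseteq> [X]\<^bsup>Suc t\<^esup>" and j: "j < g"
    and S: "S \<subseteq> X \<times> {..<g}" "finite S" "inj_on fst S" "card S = t"
  shows "bij_betw (image fst) {B \<in> blow_up g j A. S \<subseteq> B} {C \<in> A. fst ` S \<subseteq> C}"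
proof (rule bij_betw_imageI)
  let ?s = "\<Sum>p\<in>S. snd p"
  show "inj_on (image fst) {B \<in> blow_up g j A. S \<subseteq> B}"
  proof (rule inj_onI, clarsimp)
    fix B B'
    assume "B \<in> blow_up g j A" "S \<subseteq> B" and B': "B' \<in> blow_up g j A" "S \<subseteq> B'"
      and eq: "fst ` B = fst ` B'"
    then obtain c r where cr: "B = insert (c, r) S" "c \<notin> fst ` S" "r < g" "(r + ?s) mod g = j"
      using blow_up_superset_cases[OF A S(2,4)] by metis
    obtain c' r' where cr': "B' = insert (c', r') S" "c' \<notin> fst ` S" "r' < g" "(r' + ?s) mod g = j"
      using blow_up_superset_cases[OF A S(2,4) B'] by metis
    have "insert c (fst ` S) = insert c' (fst ` S)" using eq cr(1) cr'(1) by simp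
    then have "c = c'" using cr(2) cr'(2) by blast
    moreover have "r = r'" using ex1_add_mod_eq[OF j] cr(3,4) cr'(3,4) by blast
    ultimately show "B = B'" using cr(1) cr'(1) by simp
  qed
  have "C \<in> image fst ` {B \<in> blow_up g j A. S \<subseteq> B}" if C: "C \<in> A" "fst ` S \<subseteq> C" for C
  proof -
    have "card (C - fst ` S) = 1"
      using A C S by (auto simp: nsets_def card_Diff_subset card_image)
    then obtain c where "C - fst ` S = {c}" by (auto simp: card_1_singleton_iff)
    then have c: "C = insert c (fst ` S)" "c \<notin> fst ` S" using C(2) by blast+
    obtain r where r: "r < g" "(r + ?s) mod g = j" using ex1_add_mod_eq[OF j] by blast
    have "(c, r) \<notin> S" using c(2) by force
    then have "insert (c, r) S \<in> blow_up g j A"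
      using S c r C(1) by (auto simp: blow_up_def)
    moreover have "C = fst ` insert (c, r) S" using c(1) by simp
    ultimately show ?thesis by blast
  qed
  then show "image fst ` {B \<in> blow_up g j A. S \<subseteq> B} = {C \<in> A. fst ` S \<subseteq> C}"
    by (auto simp: blow_up_def)
qed

lemma degree_blow_up_not_inj:
  assumes "\<not> inj_on fst S"
  shows "degree (blow_up g j A) S = 0"
proof -
  have "{B \<in> blow_up g j A. S \<subseteq> B} = {}"
    using assms by (auto simp: blow_up_def dest: inj_on_subset)
  then show ?thesis by (simp only: degree_def card.empty)
qed

lemma sum_degree_insert_blow_up:
  assumes "finite X"
  shows "(\<Sum>p\<in>X \<times> {..<g} - S. degree (blow_up g j A) (insert p S)) =
    (\<Sum>c\<in>X - fst ` S. \<Sum>r<g. degree (blow_up g j A) (insert (c, r) S))"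
proof -
  have "degree (blow_up g j A) (insert p S) = 0"
    if p: "p \<in> X \<times> {..<g} - S - (X - fst ` S) \<times> {..<g}" for p
  proof (rule degree_blow_up_not_inj)
    have "fst p \<in> fst ` S" "p \<notin> S" using p by (auto simp: mem_Times_iff)
    then show "\<not> inj_on fst (insert p S)" by (auto simp: inj_on_def)
  qed
  then have "(\<Sum>p\<in>X \<times> {..<g} - S. degree (blow_up g j A) (insert p S)) =
    (\<Sum>p\<in>(X - fst ` S) \<times> {..<g}. degree (blow_up g j A) (insert p S))"
    using assms by (intro sum.mono_neutral_right) (auto intro: rev_image_eqI)
  then show ?thesis by (simp add: sum.cartesian_product')
qed

lemma degree_blow_up:
  assumes X: "finite X" and A: "A \<subseteq> [X]\<^bsup>Suc t\<^esup>" and j: "j < g"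
    and S: "S \<subseteq> X \<times> {..<g}" "inj_on fst S" "card S \<le> t"
  shows "degree (blow_up g j A) S = g ^ (t - card S) * degree A (fst ` S)"
  using S
proof (induction "t - card S" arbitrary: S)
  case 0
  have "finite S" using finite_subset[OF 0(2)] X by simp
  then show ?case
    using bij_betw_same_card[OF bij_betw_blow_up_supersets[OF A j]] 0 by (simp add: degree_def)
next
  case (Suc d)
  let ?A' = "blow_up g j A" and ?X' = "X \<times> {..<g}" and ?m = "Suc t - card S"
  have X': "finite ?X'" using X by simp
  have finS: "finite S" using finite_subset[OF Suc.prems(1) X'] .
  have extend: "degree ?A' (insert (c, r) S) = g ^ d * degree A (insert c (fst ` S))"
    if "c \<in> X - fst ` S" "r < g" for c r
  proof -
    have "(c, r) \<notin> S" using that(1) by force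
    then have card: "t - card (insert (c, r) S) = d" using finS Suc.hyps(2) by simp
    then show ?thesis
      using Suc.hyps(1)[of "insert (c, r) S"] Suc.hyps(2) Suc.prems that finS \<open>(c, r) \<notin> S\<close> by simp
  qed
  have "?m * degree ?A' S = (\<Sum>p\<in>?X' - S. degree ?A' (insert p S))"
    using sum_degree_insert[OF X' blow_up_subset_nsets[OF A] finS] by simp
  also have "\<dots> = (\<Sum>c\<in>X - fst ` S. \<Sum>r<g. degree ?A' (insert (c, r) S))"
    by (rule sum_degree_insert_blow_up[OF X])
  also have "\<dots> = g ^ Suc d * (\<Sum>c\<in>X - fst ` S. degree A (insert c (fst ` S)))"
    by (simp add: extend sum_distrib_left mult.assoc)
  also have "\<dots> = g ^ Suc d * (?m * degree A (fst ` S))"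
    using sum_degree_insert[OF X A, of "fst ` S"] finS Suc.prems(2) by (simp add: card_image)
  finally have "?m * degree ?A' S = ?m * (g ^ Suc d * degree A (fst ` S))"
    by (simp only: mult.left_commute)
  then show ?case using Suc.prems(3) Suc.hyps(2) by simp
qed

lemma card_blow_up:
  assumes "finite X" "A \<subseteq> [X]\<^bsup>Suc t\<^esup>" "j < g"
  shows "card (blow_up g j A) = g ^ t * card A"
  using degree_blow_up[OF assms, of "{}"] by simp

lemma is_trade_blow_up:
  assumes X: "finite X" and A: "A \<subseteq> [X]\<^bsup>Suc t\<^esup>" "A \<noteq> {}" and B: "B \<subseteq> [X]\<^bsup>Suc t\<^esup>" "B \<noteq> {}"
    and balanced: "\<And>S. S \<in> [X]\<^bsup>t\<^esup> \<Longrightarrow> degree A S = degree B S"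
    and ij: "i < g" "j < g" and disjoint: "i \<noteq> j \<or> A \<inter> B = {}"
  shows "is_trade (card X * g) (Suc t) t (X \<times> {..<g}) (blow_up g i A) (blow_up g j B)"
  unfolding is_trade_iff
proof (intro conjI ballI)
  have "0 < card (blow_up g i A)" "0 < card (blow_up g j B)"
    using card_blow_up[OF X A(1) ij(1)] card_blow_up[OF X B(1) ij(2)] A B ij
      finite_subset_nsets[OF X] by (auto simp: card_gt_0_iff)
  then show "blow_up g i A \<noteq> {}" "blow_up g j B \<noteq> {}" by auto
  show "blow_up g i A \<inter> blow_up g j B = {}" using disjoint by (auto simp: blow_up_def)
  show "degree (blow_up g i A) S = degree (blow_up g j B) S" if S: "S \<in> [X \<times> {..<g}]\<^bsup>t\<^esup>" for S
  proof (cases "inj_on fst S")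
    case True
    have "fst ` S \<in> [X]\<^bsup>t\<^esup>" using S True by (auto simp: nsets_def card_image)
    then show ?thesis
      using degree_blow_up[OF X _ _ _ True] A(1) B(1) ij S balanced by (simp add: nsets_def)
  qed (simp add: degree_blow_up_not_inj)
qed (use X blow_up_subset_nsets[OF A(1)] blow_up_subset_nsets[OF B(1)] in
    \<open>simp_all add: card_cartesian_product\<close>)

lemma (in mu_way_Suc_trade) is_mu_way_trade_blow_up:
  assumes g: "0 < g"
  shows "is_mu_way_trade (\<mu> * g) (v * g) (Suc t) t (X \<times> {..<g})
    (\<lambda>i. blow_up g ((i - 1) mod g) (T ((i - 1) div g + 1)))"
  unfolding is_mu_way_trade_def
proof (intro ballI impI)
  let ?q = "\<lambda>i. (i - 1) div g + 1" and ?r = "\<lambda>i. (i - 1) mod g"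
  fix i j assume ij: "i \<in> {1..\<mu> * g}" "j \<in> {1..\<mu> * g}" "i \<noteq> j"
  have quotient: "?q l \<in> {1..\<mu>}" if "l \<in> {1..\<mu> * g}" for l
  proof -
    have "l - 1 < \<mu> * g" using that by auto
    then show ?thesis using less_mult_imp_div_less by fastforce
  qed
  have "?r i \<noteq> ?r j" if "?q i = ?q j"
  proof -
    have "i - 1 \<noteq> j - 1" using ij by auto
    then show ?thesis using that by (metis add_right_cancel div_mult_mod_eq)
  qed
  then have "?r i \<noteq> ?r j \<or> T (?q i) \<inter> T (?q j) = {}"
    using disjoint[OF quotient[OF ij(1)] quotient[OF ij(2)]] by blast
  moreover have "degree (T (?q i)) S = degree (T (?q j)) S" if "S \<in> [X]\<^bsup>t\<^esup>" for S
    using that by (intro degree_eq quotient ij) (auto simp: nsets_def)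
  ultimately show "is_trade (v * g) (Suc t) t (X \<times> {..<g})
      (blow_up g (?r i) (T (?q i))) (blow_up g (?r j) (T (?q j)))"
    unfolding card_points[symmetric] using g
    by (intro is_trade_blow_up finite_points blocks_subset blocks_nonempty quotient ij) simp_all
qed

lemma (in mu_way_Suc_trade) min_volume_le_blow_up:
  assumes \<nu>: "2 \<le> \<nu>" "\<nu> \<le> \<mu> * g"
  shows "min_volume \<nu> (Suc t) t \<le> g ^ t * card (T 1)"
proof -
  let ?T = "\<lambda>i. blow_up g ((i - 1) mod g) (T ((i - 1) div g + 1))"
  have g: "0 < g" using \<nu> by (cases g) auto
  interpret blown_up: mu_way_trade "\<mu> * g" "v * g" "Suc t" t "X \<times> {..<g}" ?T
    using is_mu_way_trade_blow_up[OF g] \<nu> by unfold_locales auto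
  have "min_volume \<nu> (Suc t) t \<le> card (?T 1)"
    using \<nu> by (rule blown_up.min_volume_le) simp
  also have "\<dots> = g ^ t * card (T 1)"
    using card_blow_up[OF finite_points blocks_subset[OF one_index] g] by simp
  finally show ?thesis .
qed

section \<open>Small trades for every number of ways\<close>

lemma min_volume_le_cyclic_base:
  assumes D: "cyclic_base 3 n N D" and n: "2 \<le> n" and \<mu>: "2 \<le> \<mu>" "\<mu> \<le> n * g"
  shows "min_volume \<mu> 3 2 \<le> length D * g\<^sup>2"
proof -
  let ?T = "\<lambda>i. image (rotation n i) ` set ` set D"
  interpret mu_way_Suc_trade n N 2 "{..<N}" ?T
    using is_mu_way_trade_cyclic_base[OF D] n by unfold_locales simp_all
  have "min_volume \<mu> 3 2 \<le> g\<^sup>2 * card (?T 1)"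
    using min_volume_le_blow_up[OF \<mu>] by simp
  also have "card (?T 1) \<le> length D"
    by (meson card_image_le card_length finite_imageI finite_set order_trans)
  finally show ?thesis by (simp add: mult.commute)
qed

lemma cyclic_base_imp_min_volume_less:
  assumes D: "cyclic_base 3 n N D" and n: "2 \<le> n" and \<mu>: "2 \<le> \<mu>" "m \<le> \<mu>" "\<mu> \<le> n * g"
    and small: "3 * (length D * g\<^sup>2) < repeated_pair_bound m"
  shows "3 * min_volume \<mu> 3 2 < repeated_pair_bound \<mu>"
  using min_volume_le_cyclic_base[OF D n \<mu>(1,3)] small repeated_pair_bound_mono[OF \<mu>(2)]
  by linarith

text \<open>Found by computer search. The rotations of \<open>base7\<close>, \<open>base11\<close> and \<open>base17\<close> are large sets of
  disjoint Steiner triple systems of orders 9, 13 and 19, those of \<open>base4\<close> are disjoint group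
  divisible designs of type \<open>2\<^sup>4\<close>, and \<open>base3\<close> joins three points to the one-factors
  of \<open>K\<^sub>4\<close>.\<close>

definition base3 :: "nat list list" where "base3 =
  [[0, 1, 4], [0, 2, 6], [0, 3, 5], [1, 2, 5], [1, 3, 6], [2, 3, 4]]"

definition base4 :: "nat list list" where "base4 =
  [[0, 1, 6], [0, 3, 5], [0, 4, 7], [1, 2, 4], [1, 5, 7], [2, 3, 7], [2, 5, 6], [3, 4, 6]]"

definition base7 :: "nat list list" where "base7 =
  [[0, 1, 5], [0, 2, 4], [0, 3, 7], [0, 6, 8], [1, 2, 3], [1, 4, 8], [1, 6, 7], [2, 5, 6],
   [2, 7, 8], [3, 4, 6], [3, 5, 8], [4, 5, 7]]"

definition base11 :: "nat list list" where "base11 =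
  [[0, 1, 3], [0, 2, 11], [0, 4, 12], [0, 5, 9], [0, 6, 7], [0, 8, 10], [1, 2, 9], [1, 4, 6],
   [1, 5, 10], [1, 7, 12], [1, 8, 11], [2, 3, 8], [2, 4, 7], [2, 5, 12], [2, 6, 10], [3, 4, 10],
   [3, 5, 7], [3, 6, 9], [3, 11, 12], [4, 5, 8], [4, 9, 11], [5, 6, 11], [6, 8, 12], [7, 8, 9],
   [7, 10, 11], [9, 10, 12]]"

definition base17 :: "nat list list" where "base17 =
  [[0, 1, 16], [0, 2, 15], [0, 3, 14], [0, 4, 13], [0, 5, 12], [0, 6, 11], [0, 7, 10], [0, 8, 9],
   [0, 17, 18], [1, 2, 8], [1, 3, 6], [1, 4, 9], [1, 5, 17], [1, 7, 18], [1, 10, 12], [1, 11, 13],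
   [1, 14, 15], [2, 3, 16], [2, 4, 18], [2, 5, 9], [2, 6, 12], [2, 7, 11], [2, 10, 13],
   [2, 14, 17], [3, 4, 8], [3, 5, 13], [3, 7, 9], [3, 10, 11], [3, 12, 17], [3, 15, 18],
   [4, 5, 10], [4, 6, 16], [4, 7, 15], [4, 11, 17], [4, 12, 14], [5, 6, 8], [5, 7, 16],
   [5, 11, 15], [5, 14, 18], [6, 7, 14], [6, 9, 17], [6, 10, 15], [6, 13, 18], [7, 8, 17],
   [7, 12, 13], [8, 10, 14], [8, 11, 18], [8, 12, 15], [8, 13, 16], [9, 10, 18], [9, 11, 12],
   [9, 13, 14], [9, 15, 16], [10, 16, 17], [11, 14, 16], [12, 16, 18], [13, 15, 17]]"

lemma cyclic_base3: "cyclic_base 3 3 7 base3"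
  by code_simp

lemma cyclic_base4: "cyclic_base 3 4 8 base4"
  by code_simp

lemma cyclic_base7: "cyclic_base 3 7 9 base7"
  by code_simp

lemma cyclic_base11: "cyclic_base 3 11 13 base11"
  by code_simp

lemma cyclic_base17: "cyclic_base 3 17 19 base17"
  by code_simp

lemma min_volume_less_if_ge_29:
  assumes "29 \<le> \<mu>"
  shows "3 * min_volume \<mu> 3 2 < repeated_pair_bound \<mu>"
proof -
  define g where "g = (\<mu> + 6) div 7"
  have g: "5 \<le> g" "\<mu> \<le> 7 * g" "7 * g \<le> \<mu> + 6" using assms by (auto simp: g_def)
  then obtain d where d: "g = 5 + d" using le_Suc_ex by blast
  have "3 * min_volume \<mu> 3 2 \<le> 36 * g\<^sup>2"
    using min_volume_le_cyclic_base[OF cyclic_base7, of \<mu> g] g assms by (simp add: base7_def)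
  also have "\<dots> < (7 * g - 5) * (7 * g - 4)"
    by (simp add: d power2_eq_square algebra_simps)
  also have "\<dots> \<le> (\<mu> + 1) * (\<mu> + 2)" using g by (intro mult_le_mono) auto
  also have "\<dots> = 2 * (\<mu> + 1) + \<mu> * (\<mu> + 1)" by (simp add: algebra_simps)
  also have "\<dots> \<le> 2 * (\<mu> + 1) + \<mu> * (2 * (\<mu> div 2 + 1))"
    by (intro add_left_mono mult_le_mono2) auto
  finally show ?thesis by (simp add: repeated_pair_bound_def ac_simps)
qed

lemma min_volume_less_repeated_pair_bound:
  assumes "3 \<le> \<mu>"
  shows "3 * min_volume \<mu> 3 2 < repeated_pair_bound \<mu>"
proof -
  note less = cyclic_base_imp_min_volume_less
  consider (eq_3) "\<mu> = 3" | (eq_4) "\<mu> = 4" | (le_7) "\<mu> \<in> {5..7}" | (le_11) "\<mu> \<in> {8..11}"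
    | (le_17) "\<mu> \<in> {12..17}" | (le_22) "\<mu> \<in> {18..22}" | (le_28) "\<mu> \<in> {23..28}" | (ge_29) "29 \<le> \<mu>"
    using assms by fastforce
  then show ?thesis
  proof cases
    case eq_3
    then show ?thesis
      using less[OF cyclic_base3, of \<mu> 3 1] by (simp add: base3_def repeated_pair_bound_def)
  next
    case eq_4
    then show ?thesis
      using less[OF cyclic_base4, of \<mu> 4 1] by (simp add: base4_def repeated_pair_bound_def)
  next
    case le_7
    then show ?thesis
      by (intro less[OF cyclic_base7, of \<mu> 5 1]) (auto simp: base7_def repeated_pair_bound_def)
  next
    case le_11
    then show ?thesis
      by (intro less[OF cyclic_base11, of \<mu> 8 1]) (auto simp: base11_def repeated_pair_bound_def)
  next
    case le_17
    then show ?thesis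
      by (intro less[OF cyclic_base17, of \<mu> 12 1]) (auto simp: base17_def repeated_pair_bound_def)
  next
    case le_22
    then show ?thesis
      by (intro less[OF cyclic_base11, of \<mu> 18 2]) (auto simp: base11_def repeated_pair_bound_def)
  next
    case le_28
    then show ?thesis
      by (intro less[OF cyclic_base7, of \<mu> 23 4]) (auto simp: base7_def repeated_pair_bound_def)
  next
    case ge_29
    then show ?thesis by (rule min_volume_less_if_ge_29)
  qed
qed

theorem theorem3p5:
  fixes \<mu> v :: nat and X :: "'a set" and T :: "nat \<Rightarrow> 'a set set"
  assumes "\<mu> \<ge> 3"
    and "is_mu_way_trade \<mu> v 3 2 X T"
    and "has_volume \<mu> T (min_volume \<mu> 3 2)"
  shows "is_steiner \<mu> 2 X T"
proof (rule ccontr)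
  interpret mu_way_triple_trade \<mu> v X T
    using assms(1,2) by unfold_locales simp_all
  assume "\<not> is_steiner \<mu> 2 X T"
  then have "repeated_pair_bound \<mu> \<le> 3 * card (T 1)"
    by (rule not_steiner_imp_repeated_pair_bound_le)
  also have "card (T 1) = min_volume \<mu> 3 2"
    using assms(3) one_index by (simp add: has_volume_def)
  finally show False
    using min_volume_less_repeated_pair_bound[OF assms(1)] by simp
qed

end
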